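(* Let $\theta : G \to H$ be an ordered functor of ordered groupoids. Then $\theta$ induces a star-injective functor $\psi : G/\!/\ker\theta \to H$ such that $\theta = \varpi\psi$ (first $\varpi$, then $\psi$), where $\varpi: G \to G/\!/\ker\theta$, $g\mapsto [g]$, is the quotient map.
   Context: Conventions: a groupoid $G$ is a small category in which every morphism is invertible, identified with its set of arrows under partial composition; $G_0\subseteq G$ is its set of identities. An arrow $g$ has domain $g\mathbf{d}=gg^{-1}$ and range $g\mathbf{r}=g^{-1}g$, and $gh$ is defined iff $g\mathbf{r}=h\mathbf{d}$. Maps are written on the right and composed from left to right. For $e\in G_0$, $\mathrm{star}_G(e)=\{g\in G: g\mathbf{d}=e\}$. A functor $\phi:G\to H$ is star-injective if for each $e\in G_0$ the restriction $\mathrm{star}_G(e)\to\mathrm{star}_H(e\phi)$ is injective. The kernel of $\phi$ is $\ker\phi=\{g\in G: g\phi\in H_0\}$. An ordered groupoid is a groupoid $G$ with a partial order $\leq$ on arrows such that: (OG1) $g\leq h$ implies $g^{-1}\leq h^{-1}$; (OG2) if $g_1\leq g_2$, $h_1\leq h_2$ and $g_1h_1$, $g_2h_2$ are defined, then $g_1h_1\leq g_2h_2$; (OG3) if $g\in G$, $f\in G_0$ and $f\leq g\mathbf{d}$, there is a unique element $(f|g)$ with $(f|g)\mathbf{d}=f$ and $(f|g)\leq g$. If $f\in G_0$ and $f\leq g\mathbf{r}$, the corestriction is $(g|f)=(f|g^{-1})^{-1}$. An ordered functor is an order-preserving functor between ordered groupoids. A normal ordered subgroupoid of $G$ is a subgroupoid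 $A$ such that: $A_0=G_0$; if $a\in A$ and $e\in G_0$ with $e\leq aa^{-1}$ then $(e|a)\in A$; and if $a\in A$ and $h,k\in G$ have a common upper bound in $G$ and $h^{-1}ak$ is defined, then $h^{-1}ak\in A$. The kernel of an ordered functor is a normal ordered subgroupoid. For a normal ordered subgroupoid $A$ of $G$: $g\simeq_A h$ iff there exist $a,b,c,d\in A$ with $agb\leq h$ and $chd\leq g$. This is an equivalence relation; $[g]$ is the class of $g$ and $G/\!/A$ the set of classes, ordered by $[g]\leq[k]$ iff there exist $a,b\in A$ with $agb\leq k$. For $e,f\in G_0$ an $A$-nexus between $e$ and $f$ is a pair $(a,p)$ of arrows of $A$ with $aa^{-1}\leq e$, $a^{-1}a=f$, $pp^{-1}\leq f$, $p^{-1}p=e$. The composition $[g][h]$ is defined iff $g^{-1}g\simeq_A hh^{-1}$, and then $[g][h]=[(g|aa^{-1})\,a\,h]$ for any $A$-nexus $(a,p)$ between $g^{-1}g$ and $hh^{-1}$. With these structures $G/\!/A$ is an ordered groupoid. *)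

theory Defs
  imports Main
begin

section \<open>Groupoids\<close>

text \<open>
  Arrows-only presentation of a small category: an object is the same thing as its identity
  arrow. Composition is in diagrammatic order. The function \<open>cmp\<close> is total, but \<open>g \<cdot> h\<close> is
  only meaningful (``defined'') if \<open>rn g = dm h\<close>, so this condition is written out wherever a
  product is required to exist.
\<close>

record 'a gpd =
  arr :: "'a set"
  dm :: "'a \<Rightarrow> 'a"
  rn :: "'a \<Rightarrow> 'a"
  cmp :: "'a \<Rightarrow> 'a \<Rightarrow> 'a" (infixl "\<cdot>\<index>" 70)

locale groupoid =
  fixes G :: "('a, 'm) gpd_scheme" (structure)
  assumes dm_closed: "g \<in> arr G \<Longrightarrow> dm G g \<in> arr G"
    and rn_closed: "g \<in> arr G \<Longrightarrow> rn G g \<in> arr G"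
    and dm_dm: "g \<in> arr G \<Longrightarrow> dm G (dm G g) = dm G g"
    and rn_dm: "g \<in> arr G \<Longrightarrow> rn G (dm G g) = dm G g"
    and dm_rn: "g \<in> arr G \<Longrightarrow> dm G (rn G g) = rn G g"
    and rn_rn: "g \<in> arr G \<Longrightarrow> rn G (rn G g) = rn G g"
    and cmp_closed: "\<lbrakk>g \<in> arr G; h \<in> arr G; rn G g = dm G h\<rbrakk> \<Longrightarrow> g \<cdot> h \<in> arr G"
    and dm_cmp: "\<lbrakk>g \<in> arr G; h \<in> arr G; rn G g = dm G h\<rbrakk> \<Longrightarrow> dm G (g \<cdot> h) = dm G g"
    and rn_cmp: "\<lbrakk>g \<in> arr G; h \<in> arr G; rn G g = dm G h\<rbrakk> \<Longrightarrow> rn G (g \<cdot> h) = rn G h"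
    and cmp_assoc: "\<lbrakk>g \<in> arr G; h \<in> arr G; k \<in> arr G; rn G g = dm G h; rn G h = dm G k\<rbrakk>
                      \<Longrightarrow> (g \<cdot> h) \<cdot> k = g \<cdot> (h \<cdot> k)"
    and dm_cmp_id: "g \<in> arr G \<Longrightarrow> dm G g \<cdot> g = g"
    and cmp_rn_id: "g \<in> arr G \<Longrightarrow> g \<cdot> rn G g = g"
    and invertible: "g \<in> arr G \<Longrightarrow>
          \<exists>h\<in>arr G. dm G h = rn G g \<and> rn G h = dm G g \<and> g \<cdot> h = dm G g \<and> h \<cdot> g = rn G g"

definition idents :: "('a, 'm) gpd_scheme \<Rightarrow> 'a set"
  where "idents G = {e \<in> arr G. dm G e = e}"

definition ginv :: "('a, 'm) gpd_scheme \<Rightarrow> 'a \<Rightarrow> 'a"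
  where "ginv G g = (THE h. h \<in> arr G \<and> dm G h = rn G g \<and> rn G h = dm G g
                        \<and> cmp G g h = dm G g \<and> cmp G h g = rn G g)"

definition star :: "('a, 'm) gpd_scheme \<Rightarrow> 'a \<Rightarrow> 'a set"
  where "star G e = {g \<in> arr G. dm G g = e}"

locale gpd_functor = G: groupoid G + H: groupoid H
  for G :: "('a, 'm) gpd_scheme" and H :: "('b, 'n) gpd_scheme" and \<phi> :: "'a \<Rightarrow> 'b" +
  assumes map_arr: "g \<in> arr G \<Longrightarrow> \<phi> g \<in> arr H"
    and map_dm: "g \<in> arr G \<Longrightarrow> \<phi> (dm G g) = dm H (\<phi> g)"
    and map_rn: "g \<in> arr G \<Longrightarrow> \<phi> (rn G g) = rn H (\<phi> g)"
    and map_cmp: "\<lbrakk>g \<in> arr G; h \<in> arr G; rn G g = dm G h\<rbrakk>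
                    \<Longrightarrow> \<phi> (cmp G g h) = cmp H (\<phi> g) (\<phi> h)"

locale star_injective_functor = gpd_functor +
  assumes star_inj: "e \<in> idents G \<Longrightarrow> inj_on \<phi> (star G e)"

definition gpd_kernel :: "('a, 'm) gpd_scheme \<Rightarrow> ('b, 'n) gpd_scheme \<Rightarrow> ('a \<Rightarrow> 'b) \<Rightarrow> 'a set"
  where "gpd_kernel G H \<phi> = {g \<in> arr G. \<phi> g \<in> idents H}"


section \<open>Ordered groupoids\<close>

record 'a ogpd = "'a gpd" +
  ord :: "('a \<times> 'a) set"

locale ordered_groupoid = groupoid G
  for G :: "('a, 'm) ogpd_scheme" (structure) +
  assumes ord_partial_order: "partial_order_on (arr G) (ord G)"
    and OG1: "(g, h) \<in> ord G \<Longrightarrow> (ginv G g, ginv G h) \<in> ord G"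
    and OG2: "\<lbrakk>(g1, g2) \<in> ord G; (h1, h2) \<in> ord G; rn G g1 = dm G h1; rn G g2 = dm G h2\<rbrakk>
                \<Longrightarrow> (g1 \<cdot> h1, g2 \<cdot> h2) \<in> ord G"
    and OG3: "\<lbrakk>g \<in> arr G; f \<in> idents G; (f, dm G g) \<in> ord G\<rbrakk>
                \<Longrightarrow> \<exists>!x. x \<in> arr G \<and> dm G x = f \<and> (x, g) \<in> ord G"

text \<open>Restriction \<open>(f|g)\<close> and corestriction \<open>(g|f)\<close>.\<close>

definition res :: "('a, 'm) ogpd_scheme \<Rightarrow> 'a \<Rightarrow> 'a \<Rightarrow> 'a"
  where "res G f g = (THE x. x \<in> arr G \<and> dm G x = f \<and> (x, g) \<in> ord G)"

definition cores :: "('a, 'm) ogpd_scheme \<Rightarrow> 'a \<Rightarrow> 'a \<Rightarrow> 'a"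
  where "cores G g f = ginv G (res G f (ginv G g))"

locale ordered_functor = G: ordered_groupoid G + H: ordered_groupoid H + gpd_functor G H \<phi>
  for G :: "('a, 'm) ogpd_scheme" and H :: "('b, 'n) ogpd_scheme" and \<phi> :: "'a \<Rightarrow> 'b" +
  assumes map_ord: "(g, h) \<in> ord G \<Longrightarrow> (\<phi> g, \<phi> h) \<in> ord H"

locale normal_ordered_subgroupoid = ordered_groupoid G
  for G :: "('a, 'm) ogpd_scheme" (structure) and A :: "'a set" +
  assumes sub_arr: "A \<subseteq> arr G"
    and sub_inv: "a \<in> A \<Longrightarrow> ginv G a \<in> A"
    and sub_cmp: "\<lbrakk>a \<in> A; b \<in> A; rn G a = dm G b\<rbrakk> \<Longrightarrow> a \<cdot> b \<in> A"
    and wide: "idents G \<subseteq> A"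
    and sub_res: "\<lbrakk>a \<in> A; e \<in> idents G; (e, dm G a) \<in> ord G\<rbrakk> \<Longrightarrow> res G e a \<in> A"
    and normal: "\<lbrakk>a \<in> A; h \<in> arr G; k \<in> arr G; u \<in> arr G; (h, u) \<in> ord G; (k, u) \<in> ord G;
                   dm G h = dm G a; rn G a = dm G k\<rbrakk> \<Longrightarrow> ginv G h \<cdot> a \<cdot> k \<in> A"


section \<open>The quotient of an ordered groupoid by a normal ordered subgroupoid\<close>

definition qle :: "('a, 'm) ogpd_scheme \<Rightarrow> 'a set \<Rightarrow> 'a \<Rightarrow> 'a \<Rightarrow> bool"
  where "qle G A g k \<longleftrightarrow>
    (\<exists>a\<in>A. \<exists>b\<in>A. rn G a = dm G g \<and> rn G g = dm G b \<and> (cmp G (cmp G a g) b, k) \<in> ord G)"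

definition qrel :: "('a, 'm) ogpd_scheme \<Rightarrow> 'a set \<Rightarrow> ('a \<times> 'a) set"
  where "qrel G A = {(g, h). g \<in> arr G \<and> h \<in> arr G \<and> qle G A g h \<and> qle G A h g}"

definition qmap :: "('a, 'm) ogpd_scheme \<Rightarrow> 'a set \<Rightarrow> 'a \<Rightarrow> 'a set"
  where "qmap G A g = qrel G A `` {g}"

definition nexus :: "('a, 'm) ogpd_scheme \<Rightarrow> 'a set \<Rightarrow> 'a \<Rightarrow> 'a \<Rightarrow> 'a \<times> 'a \<Rightarrow> bool"
  where "nexus G A e f = (\<lambda>(a, p). a \<in> A \<and> p \<in> A \<and>
      (dm G a, e) \<in> ord G \<and> rn G a = f \<and> (dm G p, f) \<in> ord G \<and> rn G p = e)"

text \<open>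
  Domain, range and composition of classes are given by definite descriptions over all choices
  of representatives (and, for composition, of a nexus), so they take the intended value exactly
  when the result does not depend on these choices. As in any \<open>gpd\<close>, the product of \<open>X\<close> and \<open>Y\<close>
  is only meaningful if the range of \<open>X\<close> is the domain of \<open>Y\<close>; for \<open>X = [g]\<close> and \<open>Y = [h]\<close> this
  says that \<open>rn g\<close> and \<open>dm h\<close> are related by \<open>qrel G A\<close>.
\<close>

definition quotient_gpd :: "('a, 'm) ogpd_scheme \<Rightarrow> 'a set \<Rightarrow> 'a set ogpd"
  where "quotient_gpd G A =
   \<lparr>arr = arr G // qrel G A,
    dm = (\<lambda>X. THE E. \<exists>g\<in>X. E = qmap G A (dm G g)),
    rn = (\<lambda>X. THE E. \<exists>g\<in>X. E = qmap G A (rn G g)),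
    cmp = (\<lambda>X Y. THE Z. \<exists>g\<in>X. \<exists>h\<in>Y. \<exists>a p. nexus G A (rn G g) (dm G h) (a, p) \<and>
              Z = qmap G A (cmp G (cmp G (cores G g (dm G a)) a) h)),
    ord = {(qmap G A g, qmap G A k) | g k. g \<in> arr G \<and> k \<in> arr G \<and> qle G A g k}\<rparr>"


section \<open>Kernels are normal\<close>

context groupoid
begin

lemma ginv_unique:
  assumes g: "g \<in> arr G"
  shows "\<exists>!h. h \<in> arr G \<and> dm G h = rn G g \<and> rn G h = dm G g \<and> g \<cdot> h = dm G g \<and> h \<cdot> g = rn G g"
proof -
  have "h = k"
    if h: "h \<in> arr G" "dm G h = rn G g" "rn G h = dm G g" "h \<cdot> g = rn G g"
      and k: "k \<in> arr G" "dm G k = rn G g" "rn G k = dm G g" "g \<cdot> k = dm G g" for h k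
  proof -
    have "h = h \<cdot> (g \<cdot> k)" using cmp_rn_id[OF h(1)] h k by simp
    also have "\<dots> = (h \<cdot> g) \<cdot> k" using cmp_assoc[OF h(1) g k(1)] h k by simp
    also have "\<dots> = k" using dm_cmp_id[OF k(1)] h k by simp
    finally show ?thesis .
  qed
  then show ?thesis using invertible[OF g] by blast
qed

lemma
  assumes g: "g \<in> arr G"
  shows ginv_closed: "ginv G g \<in> arr G"
    and dm_ginv: "dm G (ginv G g) = rn G g"
    and rn_ginv: "rn G (ginv G g) = dm G g"
    and cmp_ginv: "g \<cdot> ginv G g = dm G g"
    and ginv_cmp: "ginv G g \<cdot> g = rn G g"
  using theI'[OF ginv_unique[OF g]] unfolding ginv_def by simp_all

lemma idents_rn: "e \<in> idents G \<Longrightarrow> rn G e = e"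
  unfolding idents_def using rn_dm by fastforce

lemma idents_cmp_left: "\<lbrakk>e \<in> idents G; g \<in> arr G; e = dm G g\<rbrakk> \<Longrightarrow> e \<cdot> g = g"
  using dm_cmp_id by simp

lemma dm_idents: "g \<in> arr G \<Longrightarrow> dm G g \<in> idents G"
  unfolding idents_def using dm_closed dm_dm by simp

lemma rn_idents: "g \<in> arr G \<Longrightarrow> rn G g \<in> idents G"
  unfolding idents_def using rn_closed dm_rn by simp

end

context gpd_functor
begin

lemma map_ginv:
  assumes g: "g \<in> arr G"
  shows "\<phi> (ginv G g) = ginv H (\<phi> g)"
proof -
  note i = G.ginv_closed[OF g] G.dm_ginv[OF g] G.rn_ginv[OF g]
  have "\<phi> (ginv G g) \<in> arr H \<and> dm H (\<phi> (ginv G g)) = rn H (\<phi> g) \<and>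
        rn H (\<phi> (ginv G g)) = dm H (\<phi> g) \<and>
        cmp H (\<phi> g) (\<phi> (ginv G g)) = dm H (\<phi> g) \<and>
        cmp H (\<phi> (ginv G g)) (\<phi> g) = rn H (\<phi> g)"
    using g i map_arr map_dm[OF g] map_rn[OF g] map_dm[OF i(1)] map_rn[OF i(1)]
      map_cmp[OF g i(1)] map_cmp[OF i(1) g] G.cmp_ginv[OF g] G.ginv_cmp[OF g] by simp
  then show ?thesis
    unfolding ginv_def[of H] by (rule the1_equality[OF H.ginv_unique[OF map_arr[OF g]], symmetric])
qed

lemma map_idents: "e \<in> idents G \<Longrightarrow> \<phi> e \<in> idents H"
  unfolding idents_def using map_arr map_dm by fastforce

end

context ordered_groupoid
begin

lemma ord_arr: "(g, h) \<in> ord G \<Longrightarrow> g \<in> arr G \<and> h \<in> arr G"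
  using ord_partial_order unfolding partial_order_on_def preorder_on_def by blast

lemma ord_antisym: "\<lbrakk>(g, h) \<in> ord G; (h, g) \<in> ord G\<rbrakk> \<Longrightarrow> g = h"
  using ord_partial_order unfolding partial_order_on_def by (auto dest: antisymD)

lemma ord_refl: "g \<in> arr G \<Longrightarrow> (g, g) \<in> ord G"
  using ord_partial_order unfolding partial_order_on_def preorder_on_def by (auto dest: refl_onD)

lemma dm_mono: "(g, h) \<in> ord G \<Longrightarrow> (dm G g, dm G h) \<in> ord G"
  using OG2[OF _ OG1, of g h g h] ord_arr[of g h] cmp_ginv dm_ginv by simp

lemma res_props:
  assumes "g \<in> arr G" "f \<in> idents G" "(f, dm G g) \<in> ord G"
  shows "res G f g \<in> arr G" "dm G (res G f g) = f" "(res G f g, g) \<in> ord G"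
  using theI'[OF OG3[OF assms]] unfolding res_def by simp_all

lemma below_eq: "\<lbrakk>(g, u) \<in> ord G; (h, u) \<in> ord G; dm G g = dm G h\<rbrakk> \<Longrightarrow> g = h"
  using OG3[of u "dm G g"] ord_arr dm_idents dm_mono by metis

lemma below_ident:
  assumes "(g, e) \<in> ord G" "e \<in> idents G"
  shows "g \<in> idents G"
proof -
  have "dm G e = e" using assms(2) unfolding idents_def by simp
  then have "(dm G g, e) \<in> ord G" using dm_mono[OF assms(1)] by simp
  moreover have "dm G (dm G g) = dm G g" using ord_arr[OF assms(1)] dm_dm by simp
  ultimately have "g = dm G g" using below_eq[OF assms(1)] by simp
  then show ?thesis using dm_idents ord_arr[OF assms(1)] by metis
qed

end

lemma (in ordered_functor) kernel_normal: "normal_ordered_subgroupoid G (gpd_kernel G H \<phi>)"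
proof
  show "gpd_kernel G H \<phi> \<subseteq> arr G" unfolding gpd_kernel_def by blast
  show "idents G \<subseteq> gpd_kernel G H \<phi>"
    unfolding gpd_kernel_def using map_idents by (auto simp: idents_def)
next
  fix a assume "a \<in> gpd_kernel G H \<phi>"
  then have a: "a \<in> arr G" "\<phi> a \<in> idents H" unfolding gpd_kernel_def by auto
  have arr: "\<phi> a \<in> arr H" using map_arr[OF a(1)] .
  have "ginv H (\<phi> a) = \<phi> a"
    using H.dm_cmp_id[OF H.ginv_closed[OF arr]] H.dm_ginv[OF arr] H.idents_rn[OF a(2)]
      H.cmp_ginv[OF arr] a(2) unfolding idents_def by simp
  then show "ginv G a \<in> gpd_kernel G H \<phi>"
    unfolding gpd_kernel_def using a map_ginv[OF a(1)] G.ginv_closed by simp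
next
  fix a b assume "a \<in> gpd_kernel G H \<phi>" "b \<in> gpd_kernel G H \<phi>" and c: "rn G a = dm G b"
  then have a: "a \<in> arr G" "\<phi> a \<in> idents H" and b: "b \<in> arr G" "\<phi> b \<in> idents H"
    unfolding gpd_kernel_def by auto
  have "\<phi> a = dm H (\<phi> b)" using c map_rn[OF a(1)] map_dm[OF b(1)] H.idents_rn[OF a(2)] by simp
  then have "\<phi> (cmp G a b) = \<phi> b"
    using map_cmp[OF a(1) b(1) c] H.idents_cmp_left[OF a(2) map_arr[OF b(1)]] by simp
  then show "cmp G a b \<in> gpd_kernel G H \<phi>"
    unfolding gpd_kernel_def using b G.cmp_closed[OF a(1) b(1) c] by simp
next
  fix a e assume "a \<in> gpd_kernel G H \<phi>" and e: "e \<in> idents G" "(e, dm G a) \<in> ord G"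
  then have a: "a \<in> arr G" "\<phi> a \<in> idents H" unfolding gpd_kernel_def by auto
  show "res G e a \<in> gpd_kernel G H \<phi>"
    unfolding gpd_kernel_def
    using G.res_props[OF a(1) e] H.below_ident[OF map_ord a(2)] by simp
next
  fix a h k u
  assume "a \<in> gpd_kernel G H \<phi>" and h: "h \<in> arr G" and k: "k \<in> arr G"
    and u: "(h, u) \<in> ord G" "(k, u) \<in> ord G" and c: "dm G h = dm G a" "rn G a = dm G k"
  then have a: "a \<in> arr G" "\<phi> a \<in> idents H" unfolding gpd_kernel_def by auto
  note i = G.ginv_closed[OF h] G.dm_ginv[OF h] G.rn_ginv[OF h]
  have ia: "rn G (ginv G h) = dm G a" using i c by simp
  have iak: "rn G (cmp G (ginv G h) a) = dm G k" using G.rn_cmp[OF i(1) a(1) ia] c by simp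
  have ia_arr: "cmp G (ginv G h) a \<in> arr G" using G.cmp_closed[OF i(1) a(1) ia] .
  have pa: "\<phi> a = dm H (\<phi> h)" "\<phi> a = dm H (\<phi> k)"
    using map_dm[OF h] map_dm[OF k] map_dm[OF a(1)] map_rn[OF a(1)] c a(2) H.idents_rn[OF a(2)]
    unfolding idents_def by simp_all
  then have hk: "\<phi> h = \<phi> k" using H.below_eq[OF map_ord[OF u(1)] map_ord[OF u(2)]] by simp
  have "\<phi> (cmp G (cmp G (ginv G h) a) k) = cmp H (cmp H (ginv H (\<phi> h)) (\<phi> a)) (\<phi> k)"
    using map_cmp[OF ia_arr k iak] map_cmp[OF i(1) a(1) ia] map_ginv[OF h] by simp
  also have "\<dots> = cmp H (ginv H (\<phi> h)) (\<phi> k)"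
    using H.cmp_rn_id[OF H.ginv_closed[OF map_arr[OF h]]] H.rn_ginv[OF map_arr[OF h]] pa by simp
  also have "\<dots> = rn H (\<phi> k)" using hk H.ginv_cmp[OF map_arr[OF k]] by simp
  finally show "cmp G (cmp G (ginv G h) a) k \<in> gpd_kernel G H \<phi>"
    unfolding gpd_kernel_def using H.rn_idents[OF map_arr[OF k]] G.cmp_closed[OF ia_arr k iak] by simp
qed

end

theory Submission
  imports Defs
begin

text \<open>
  Write \<open>K\<close> for the kernel of an ordered functor \<open>\<phi> : G \<rightarrow> H\<close>. The theorem rests on one description of
  the preorder defining \<open>G // K\<close>: \<open>[g] \<le> [h]\<close> holds iff \<open>\<phi> g \<le> \<phi> h\<close> and some arrow of \<open>K\<close> leads from an
  identity below the domain of \<open>h\<close> to the domain of \<open>g\<close> (lemma \<open>qle_kernel_iff\<close>). The reason is that,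
  given such an arrow \<open>a\<close>, the restriction \<open>x\<close> of \<open>h\<close> to the domain of \<open>a\<close> and the product \<open>a g\<close> have the
  same image: both images lie below \<open>\<phi> h\<close> and have the same domain. Hence \<open>b = (a g)\<inverse> x\<close> is
  in \<open>K\<close>, and \<open>a g b = x \<le> h\<close>.

  Consequently \<open>[g] = [h]\<close> iff \<open>\<phi> g = \<phi> h\<close> and \<open>[dm g] = [dm h]\<close> (lemma \<open>class_eq_iff\<close>). The ``if''
  direction is star-injectivity of the induced map \<open>[g] \<mapsto> \<phi> g\<close>. It also makes the quotient
  manageable: an arrow of \<open>G // K\<close> is determined by its domain and its image
  in \<open>H\<close>. A product \<open>[g][h]\<close>, for any choice of representatives and nexus, has domain \<open>[dm g]\<close> and image
  \<open>\<phi> g \<cdot> \<phi> h\<close> (lemma \<open>nexus_product\<close>), so it is well defined, and associativity is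
  inherited from \<open>H\<close>.
\<close>

section \<open>Corestriction and half-nexuses\<close>

context groupoid
begin

lemma ginv_ginv: "g \<in> arr G \<Longrightarrow> ginv G (ginv G g) = g"
  unfolding ginv_def[of G "ginv G g"]
  by (rule the1_equality[OF ginv_unique])
     (simp_all add: ginv_closed dm_ginv rn_ginv cmp_ginv ginv_cmp)

lemma cmp_ginv_cmp:
  assumes "g \<in> arr G" "x \<in> arr G" "dm G g = dm G x"
  shows "g \<cdot> (ginv G g \<cdot> x) = x"
  using assms cmp_assoc[of g "ginv G g" x]
  by (simp add: ginv_closed dm_ginv rn_ginv cmp_ginv dm_cmp_id)

end

context ordered_groupoid
begin

lemma ord_trans: "\<lbrakk>(g, h) \<in> ord G; (h, k) \<in> ord G\<rbrakk> \<Longrightarrow> (g, k) \<in> ord G"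
  using ord_partial_order unfolding partial_order_on_def preorder_on_def by (auto dest: transD)

lemma rn_mono: "(g, h) \<in> ord G \<Longrightarrow> (rn G g, rn G h) \<in> ord G"
  using dm_mono[OF OG1] ord_arr dm_ginv by metis

lemma below_eq_rn: "\<lbrakk>(g, u) \<in> ord G; (h, u) \<in> ord G; rn G g = rn G h\<rbrakk> \<Longrightarrow> g = h"
  using below_eq[OF OG1 OG1] ord_arr dm_ginv ginv_ginv by metis

lemma
  assumes g: "g \<in> arr G" and f: "f \<in> idents G" "(f, rn G g) \<in> ord G"
  shows cores_closed: "cores G g f \<in> arr G"
    and rn_cores: "rn G (cores G g f) = f"
    and cores_le: "(cores G g f, g) \<in> ord G"
proof -
  have r: "res G f (ginv G g) \<in> arr G" "dm G (res G f (ginv G g)) = f"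
    "(res G f (ginv G g), ginv G g) \<in> ord G"
    using res_props[OF ginv_closed[OF g] f(1)] f(2) dm_ginv[OF g] by simp_all
  show "cores G g f \<in> arr G" "rn G (cores G g f) = f"
    unfolding cores_def using r ginv_closed rn_ginv by simp_all
  show "(cores G g f, g) \<in> ord G"
    unfolding cores_def using OG1[OF r(3)] ginv_ginv[OF g] by simp
qed

end

text \<open>
  One half of a nexus between \<open>f\<close> and \<open>e\<close>. Between identities this is the relation that defines the
  order of the quotient.
\<close>

definition subconj :: "('a, 'm) ogpd_scheme \<Rightarrow> 'a set \<Rightarrow> 'a \<Rightarrow> 'a \<Rightarrow> bool"
  where "subconj G A e f \<longleftrightarrow> (\<exists>a\<in>A. rn G a = e \<and> (dm G a, f) \<in> ord G)"

context normal_ordered_subgroupoid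
begin

lemma subconj_of_le: "\<lbrakk>e \<in> idents G; (e, f) \<in> ord G\<rbrakk> \<Longrightarrow> subconj G A e f"
  unfolding subconj_def using wide idents_rn by (auto simp: idents_def intro!: bexI[of _ e])

lemma sub_cores:
  assumes "a \<in> A" "f \<in> idents G" "(f, rn G a) \<in> ord G"
  shows "cores G a f \<in> A"
  unfolding cores_def using assms sub_arr dm_ginv by (auto intro!: sub_inv sub_res)

lemma subconj_trans:
  assumes "subconj G A e f" "subconj G A f k"
  shows "subconj G A e k"
proof -
  obtain a where a: "a \<in> A" "rn G a = e" "(dm G a, f) \<in> ord G"
    using assms(1) unfolding subconj_def by blast
  obtain c where c: "c \<in> A" "rn G c = f" "(dm G c, k) \<in> ord G"
    using assms(2) unfolding subconj_def by blast
  have arr: "a \<in> arr G" "c \<in> arr G" using a c sub_arr by auto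
  have fa: "dm G a \<in> idents G" "(dm G a, rn G c) \<in> ord G" using dm_idents arr a c by auto
  let ?c = "cores G c (dm G a)"
  have c': "?c \<in> A" "?c \<in> arr G" "rn G ?c = dm G a" "(?c, c) \<in> ord G"
    using sub_cores[OF c(1) fa] cores_closed[OF arr(2) fa] rn_cores[OF arr(2) fa]
      cores_le[OF arr(2) fa] by auto
  have "?c \<cdot> a \<in> A" using sub_cmp[OF c'(1) a(1) c'(3)] .
  moreover have "rn G (?c \<cdot> a) = e" using rn_cmp[OF c'(2) arr(1) c'(3)] a by simp
  moreover have "(dm G (?c \<cdot> a), k) \<in> ord G"
    using dm_cmp[OF c'(2) arr(1) c'(3)] ord_trans[OF dm_mono[OF c'(4)] c(3)] by simp
  ultimately show ?thesis unfolding subconj_def by blast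
qed

lemma nexus_iff_subconj:
  "(\<exists>a p. nexus G A e f (a, p)) \<longleftrightarrow> subconj G A e f \<and> subconj G A f e"
  unfolding nexus_def subconj_def by auto

end


section \<open>The quotient relation of a kernel\<close>

context ordered_functor
begin

abbreviation K :: "'a set" where "K \<equiv> gpd_kernel G H \<phi>"
abbreviation Q :: "'a set ogpd" where "Q \<equiv> quotient_gpd G K"
abbreviation cls :: "'a \<Rightarrow> 'a set" where "cls \<equiv> qmap G K"

interpretation K: normal_ordered_subgroupoid G K
  by (rule kernel_normal)

lemma kernel_arr: "a \<in> K \<Longrightarrow> a \<in> arr G"
  unfolding gpd_kernel_def by simp

lemma
  assumes "a \<in> K"
  shows map_kernel_dm: "\<phi> (dm G a) = \<phi> a"
    and map_kernel_rn: "\<phi> (rn G a) = \<phi> a"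
  using assms map_dm map_rn H.idents_rn unfolding gpd_kernel_def idents_def by auto

lemma map_cmp_kernel_left:
  assumes "a \<in> K" "g \<in> arr G" "rn G a = dm G g"
  shows "\<phi> (cmp G a g) = \<phi> g"
  using assms map_cmp[OF kernel_arr[OF assms(1)] assms(2,3)] map_kernel_rn[OF assms(1)]
    map_dm[OF assms(2)] H.dm_cmp_id[OF map_arr[OF assms(2)]] by simp

lemma map_cmp_kernel_right:
  assumes "b \<in> K" "g \<in> arr G" "rn G g = dm G b"
  shows "\<phi> (cmp G g b) = \<phi> g"
  using assms map_cmp[OF assms(2) kernel_arr[OF assms(1)] assms(3)] map_kernel_dm[OF assms(1)]
    map_rn[OF assms(2)] H.cmp_rn_id[OF map_arr[OF assms(2)]] by simp

lemma subconj_map_le: "subconj G K e f \<Longrightarrow> (\<phi> e, \<phi> f) \<in> ord H"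
  unfolding subconj_def using map_ord map_kernel_dm map_kernel_rn by metis

lemma quotient_cmp_kernel:
  assumes "g \<in> arr G" "x \<in> arr G" "dm G g = dm G x" "\<phi> g = \<phi> x"
  shows "cmp G (ginv G g) x \<in> K"
  using assms G.rn_ginv[OF assms(1)] G.ginv_closed[OF assms(1)] map_ginv[OF assms(1)]
    map_cmp[of "ginv G g" x] G.cmp_closed[of "ginv G g" x]
    H.ginv_cmp[OF map_arr[OF assms(2)]] H.rn_idents[OF map_arr[OF assms(2)]]
  unfolding gpd_kernel_def by simp

lemma qle_parts:
  assumes g: "g \<in> arr G" and h: "h \<in> arr G" and "qle G K g h"
  shows "subconj G K (dm G g) (dm G h)" "subconj G K (rn G g) (rn G h)" "(\<phi> g, \<phi> h) \<in> ord H"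
proof -
  obtain a b where a: "a \<in> K" "rn G a = dm G g" and b: "b \<in> K" "rn G g = dm G b"
    and le: "(cmp G (cmp G a g) b, h) \<in> ord G"
    using assms(3) unfolding qle_def by blast
  note arr = kernel_arr[OF a(1)] kernel_arr[OF b(1)]
  have ag: "cmp G a g \<in> arr G" "dm G (cmp G a g) = dm G a" "rn G (cmp G a g) = dm G b"
    using G.cmp_closed[OF arr(1) g a(2)] G.dm_cmp[OF arr(1) g a(2)] G.rn_cmp[OF arr(1) g a(2)] b(2)
    by simp_all
  have "(dm G a, dm G h) \<in> ord G"
    using G.dm_mono[OF le] G.dm_cmp[OF ag(1) arr(2) ag(3)] ag(2) by simp
  then show "subconj G K (dm G g) (dm G h)" unfolding subconj_def using a by blast
  have "(rn G b, rn G h) \<in> ord G"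
    using G.rn_mono[OF le] G.rn_cmp[OF ag(1) arr(2) ag(3)] by simp
  then show "subconj G K (rn G g) (rn G h)"
    unfolding subconj_def using K.sub_inv[OF b(1)] G.dm_ginv[OF arr(2)] G.rn_ginv[OF arr(2)] b(2)
    by auto
  show "(\<phi> g, \<phi> h) \<in> ord H"
    using map_ord[OF le] map_cmp_kernel_right[OF b(1) ag(1) ag(3)] map_cmp_kernel_left[OF a(1) g a(2)]
    by simp
qed

text \<open>
  An arrow below \<open>\<phi> h\<close> is determined by its domain. So once the domain of \<open>g\<close> has been moved below that
  of \<open>h\<close>, the images of \<open>g\<close> and of a restriction of \<open>h\<close> coincide, and the two arrows differ by an element
  of the kernel.
\<close>

lemma qle_kernel_iff:
  assumes g: "g \<in> arr G" and h: "h \<in> arr G"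
  shows "qle G K g h \<longleftrightarrow> subconj G K (dm G g) (dm G h) \<and> (\<phi> g, \<phi> h) \<in> ord H"
proof
  assume "qle G K g h"
  then show "subconj G K (dm G g) (dm G h) \<and> (\<phi> g, \<phi> h) \<in> ord H" using qle_parts[OF g h] by simp
next
  assume R: "subconj G K (dm G g) (dm G h) \<and> (\<phi> g, \<phi> h) \<in> ord H"
  then obtain a where a: "a \<in> K" "rn G a = dm G g" "(dm G a, dm G h) \<in> ord G"
    unfolding subconj_def by blast
  note a_arr = kernel_arr[OF a(1)]
  note ag = G.cmp_closed[OF a_arr g a(2)] G.dm_cmp[OF a_arr g a(2)] G.rn_cmp[OF a_arr g a(2)]
  define x where "x = res G (dm G a) h"
  have x: "x \<in> arr G" "dm G x = dm G a" "(x, h) \<in> ord G"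
    unfolding x_def using G.res_props[OF h G.dm_idents[OF a_arr] a(3)] by auto
  have "dm H (\<phi> x) = dm H (\<phi> g)"
    using map_dm[OF x(1)] map_dm[OF g] x(2) a(2) map_kernel_dm[OF a(1)] map_kernel_rn[OF a(1)] by simp
  then have "\<phi> x = \<phi> g" using H.below_eq[OF map_ord[OF x(3)]] R by blast
  then have "\<phi> (cmp G a g) = \<phi> x" using map_cmp_kernel_left[OF a(1) g a(2)] by simp
  then have b: "cmp G (ginv G (cmp G a g)) x \<in> K"
    using quotient_cmp_kernel[OF ag(1) x(1)] ag(2) x(2) by simp
  have db: "dm G (cmp G (ginv G (cmp G a g)) x) = rn G g"
    using G.dm_cmp[OF G.ginv_closed[OF ag(1)] x(1)] G.rn_ginv[OF ag(1)] G.dm_ginv[OF ag(1)] ag(2,3) x(2)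
    by simp
  have "cmp G (cmp G a g) (cmp G (ginv G (cmp G a g)) x) = x"
    using G.cmp_ginv_cmp[OF ag(1) x(1)] ag(2) x(2) by simp
  then show "qle G K g h" unfolding qle_def using a b db x(3) by metis
qed

text \<open>
  The relation is compatible with inversion, so ranges can be used instead of domains. The arrow
  between the domains is the given arrow between the ranges, conjugated by \<open>g\<close> and a
  corestriction of \<open>h\<close> with the same image as \<open>g\<close>.
\<close>

lemma subconj_dm_if_rn:
  assumes g: "g \<in> arr G" and h: "h \<in> arr G"
    and s: "subconj G K (rn G g) (rn G h)" and le: "(\<phi> g, \<phi> h) \<in> ord H"
  shows "subconj G K (dm G g) (dm G h)"
proof -
  obtain p where p: "p \<in> K" "rn G p = rn G g" "(dm G p, rn G h) \<in> ord G"
    using s unfolding subconj_def by blast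
  note p_arr = kernel_arr[OF p(1)]
  define x where "x = cores G h (dm G p)"
  have x: "x \<in> arr G" "rn G x = dm G p" "(x, h) \<in> ord G"
    unfolding x_def using G.cores_closed[OF h G.dm_idents[OF p_arr] p(3)]
      G.rn_cores[OF h G.dm_idents[OF p_arr] p(3)] G.cores_le[OF h G.dm_idents[OF p_arr] p(3)] by auto
  have "rn H (\<phi> x) = rn H (\<phi> g)"
    using map_rn[OF x(1)] map_rn[OF g] x(2) p(2) map_kernel_dm[OF p(1)] map_kernel_rn[OF p(1)] by simp
  then have xg: "\<phi> x = \<phi> g" using H.below_eq_rn[OF map_ord[OF x(3)] le] by blast
  let ?xp = "cmp G x p"
  note xp = G.cmp_closed[OF x(1) p_arr x(2)] G.dm_cmp[OF x(1) p_arr x(2)] G.rn_cmp[OF x(1) p_arr x(2)]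
  note i = G.ginv_closed[OF g] G.dm_ginv[OF g] G.rn_ginv[OF g]
  have c: "rn G ?xp = dm G (ginv G g)" using xp(3) p(2) i(2) by simp
  have "\<phi> ?xp = \<phi> g" using map_cmp_kernel_right[OF p(1) x(1) x(2)] xg by simp
  then have "\<phi> (cmp G ?xp (ginv G g)) = dm H (\<phi> g)"
    using map_cmp[OF xp(1) i(1) c] map_ginv[OF g] H.cmp_ginv[OF map_arr[OF g]] by simp
  then have "cmp G ?xp (ginv G g) \<in> K"
    unfolding gpd_kernel_def using G.cmp_closed[OF xp(1) i(1) c] H.dm_idents[OF map_arr[OF g]] by simp
  moreover have "rn G (cmp G ?xp (ginv G g)) = dm G g" using G.rn_cmp[OF xp(1) i(1) c] i(3) by simp
  moreover have "(dm G (cmp G ?xp (ginv G g)), dm G h) \<in> ord G"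
    using G.dm_cmp[OF xp(1) i(1) c] xp(2) G.dm_mono[OF x(3)] by simp
  ultimately show ?thesis unfolding subconj_def by blast
qed

lemma equiv_qrel: "equiv (arr G) (qrel G K)"
proof (rule equivI)
  show "refl_on (arr G) (qrel G K)"
    unfolding refl_on_def qrel_def
    using qle_kernel_iff K.subconj_of_le G.dm_idents G.ord_refl G.dm_closed H.ord_refl map_arr by auto
  show "qrel G K \<subseteq> arr G \<times> arr G" unfolding qrel_def by auto
  show "sym (qrel G K)" unfolding sym_def qrel_def by auto
  have "qle G K g k" if "g \<in> arr G" "h \<in> arr G" "k \<in> arr G" "qle G K g h" "qle G K h k" for g h k
    using that qle_kernel_iff K.subconj_trans[of "dm G g" "dm G h" "dm G k"]
      H.ord_trans[of "\<phi> g" "\<phi> h" "\<phi> k"] by simp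
  then show "trans (qrel G K)" unfolding trans_def qrel_def by fast
qed

lemma class_eq_iff_qle:
  "\<lbrakk>g \<in> arr G; h \<in> arr G\<rbrakk> \<Longrightarrow> cls g = cls h \<longleftrightarrow> qle G K g h \<and> qle G K h g"
  unfolding qmap_def using eq_equiv_class_iff[OF equiv_qrel] by (auto simp: qrel_def)

lemma mem_class_iff: "g \<in> arr G \<Longrightarrow> h \<in> cls g \<longleftrightarrow> h \<in> arr G \<and> cls h = cls g"
  using class_eq_iff_qle unfolding qmap_def qrel_def by auto

lemma class_ident_eq_iff:
  assumes "e \<in> idents G" "f \<in> idents G"
  shows "cls e = cls f \<longleftrightarrow> subconj G K e f \<and> subconj G K f e"
  using assms class_eq_iff_qle qle_kernel_iff subconj_map_le unfolding idents_def by auto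

text \<open>
  Read from right to left, this is the star-injectivity of the induced functor.
\<close>

lemma class_eq_iff:
  assumes g: "g \<in> arr G" and h: "h \<in> arr G"
  shows "cls g = cls h \<longleftrightarrow> \<phi> g = \<phi> h \<and> cls (dm G g) = cls (dm G h)"
  using class_eq_iff_qle[OF g h] qle_kernel_iff[OF g h] qle_kernel_iff[OF h g]
    class_ident_eq_iff[OF G.dm_idents[OF g] G.dm_idents[OF h]] H.ord_antisym
    H.ord_refl[OF map_arr[OF g]] by auto

lemma class_rn_eq:
  assumes g: "g \<in> arr G" and h: "h \<in> arr G" and "cls g = cls h"
  shows "cls (rn G g) = cls (rn G h)"
  using assms class_eq_iff_qle[OF g h] qle_parts(2)[OF g h] qle_parts(2)[OF h g]
    class_ident_eq_iff[OF G.rn_idents[OF g] G.rn_idents[OF h]] by simp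

lemma class_dm_eq_if_rn:
  assumes g: "g \<in> arr G" and h: "h \<in> arr G" and "\<phi> g = \<phi> h" and "cls (rn G g) = cls (rn G h)"
  shows "cls (dm G g) = cls (dm G h)"
  using assms subconj_dm_if_rn[OF g h] subconj_dm_if_rn[OF h g] H.ord_refl[OF map_arr[OF g]]
    class_ident_eq_iff[OF G.rn_idents[OF g] G.rn_idents[OF h]]
    class_ident_eq_iff[OF G.dm_idents[OF g] G.dm_idents[OF h]] by simp


section \<open>The quotient groupoid of a kernel\<close>

lemma class_closed: "g \<in> arr G \<Longrightarrow> cls g \<in> arr Q"
  unfolding quotient_gpd_def qmap_def by (simp add: quotientI)

lemma class_cases:
  assumes "X \<in> arr Q"
  obtains g where "g \<in> arr G" "X = cls g"
  using assms unfolding quotient_gpd_def qmap_def by (auto elim: quotientE)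

lemma dm_class: "g \<in> arr G \<Longrightarrow> dm Q (cls g) = cls (dm G g)"
  unfolding quotient_gpd_def
  by (auto intro!: the_equality simp: mem_class_iff class_eq_iff)

lemma rn_class: "g \<in> arr G \<Longrightarrow> rn Q (cls g) = cls (rn G g)"
  unfolding quotient_gpd_def
  by (simp, rule the_equality) (use mem_class_iff class_rn_eq in blast)+

text \<open>
  The image and the domain class of the product do not involve the nexus, so by
  \<open>class_eq_iff\<close> the class of the product does not depend on it. Both halves of the nexus matter:
  \<open>a\<close> alone only gives a product whose domain lies below that of \<open>g\<close>.
\<close>

lemma nexus_product:
  assumes g: "g \<in> arr G" and h: "h \<in> arr G" and n: "nexus G K (rn G g) (dm G h) (a, p)"
  defines "w \<equiv> cmp G (cmp G (cores G g (dm G a)) a) h"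
  shows "w \<in> arr G" "\<phi> w = cmp H (\<phi> g) (\<phi> h)" "cls (dm G w) = cls (dm G g)" "rn G w = rn G h"
proof -
  have a: "a \<in> K" "(dm G a, rn G g) \<in> ord G" "rn G a = dm G h"
    using n unfolding nexus_def by auto
  note a_arr = kernel_arr[OF a(1)]
  note da = G.dm_idents[OF a_arr]
  have rd: "cls (rn G g) = cls (dm G h)"
    using n K.nexus_iff_subconj class_ident_eq_iff[OF G.rn_idents[OF g] G.dm_idents[OF h]] by blast
  have ca: "cls (dm G a) = cls (rn G a)"
    using a_arr K.sub_inv[OF a(1)] a(1) G.ord_refl G.dm_ginv G.rn_ginv G.dm_closed G.rn_closed
      class_ident_eq_iff[OF da G.rn_idents[OF a_arr]] unfolding subconj_def by metis
  define x where "x = cores G g (dm G a)"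
  have x: "x \<in> arr G" "rn G x = dm G a" "(x, g) \<in> ord G"
    unfolding x_def using G.cores_closed[OF g da a(2)] G.rn_cores[OF g da a(2)]
      G.cores_le[OF g da a(2)] by auto
  have rx: "cls (rn G x) = cls (rn G g)" using x(2) ca rd a(3) by simp
  then have "\<phi> (rn G x) = \<phi> (rn G g)"
    using class_eq_iff[OF G.rn_closed[OF x(1)] G.rn_closed[OF g]] by simp
  then have xg: "\<phi> x = \<phi> g"
    using H.below_eq_rn[OF map_ord[OF x(3)] H.ord_refl[OF map_arr[OF g]]] map_rn x(1) g by simp
  note xa = G.cmp_closed[OF x(1) a_arr x(2)] G.dm_cmp[OF x(1) a_arr x(2)] G.rn_cmp[OF x(1) a_arr x(2)]
  have c: "rn G (cmp G x a) = dm G h" using xa(3) a(3) by simp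
  show "w \<in> arr G" "rn G w = rn G h"
    unfolding w_def x_def[symmetric] using G.cmp_closed[OF xa(1) h c] G.rn_cmp[OF xa(1) h c] by auto
  show "\<phi> w = cmp H (\<phi> g) (\<phi> h)"
    unfolding w_def x_def[symmetric]
    using map_cmp[OF xa(1) h c] map_cmp_kernel_right[OF a(1) x(1) x(2)] xg by simp
  have "dm G w = dm G x" unfolding w_def x_def[symmetric] using G.dm_cmp[OF xa(1) h c] xa(2) by simp
  then show "cls (dm G w) = cls (dm G g)" using class_dm_eq_if_rn[OF x(1) g xg rx] by simp
qed

lemma cmp_class:
  assumes g: "g \<in> arr G" and h: "h \<in> arr G" and c: "cls (rn G g) = cls (dm G h)"
  obtains w where "w \<in> arr G" "cmp Q (cls g) (cls h) = cls w" "\<phi> w = cmp H (\<phi> g) (\<phi> h)"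
    "cls (dm G w) = cls (dm G g)" "cls (rn G w) = cls (rn G h)"
proof -
  have "\<exists>a p. nexus G K (rn G g) (dm G h) (a, p)"
    using K.nexus_iff_subconj class_ident_eq_iff[OF G.rn_idents[OF g] G.dm_idents[OF h]] c by blast
  then obtain a p where n: "nexus G K (rn G g) (dm G h) (a, p)" by blast
  define w where "w = cmp G (cmp G (cores G g (dm G a)) a) h"
  note w = nexus_product[OF g h n, folded w_def]
  let ?P = "\<lambda>Z. \<exists>g'\<in>cls g. \<exists>h'\<in>cls h. \<exists>a p. nexus G K (rn G g') (dm G h') (a, p) \<and>
              Z = cls (cmp G (cmp G (cores G g' (dm G a)) a) h')"
  have "(THE Z. ?P Z) = cls w"
  proof (rule the_equality)
    show "?P (cls w)" unfolding w_def using n g h mem_class_iff by blast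
  next
    fix Z assume "?P Z"
    then obtain g' h' b q where g': "g' \<in> arr G" "cls g' = cls g" and h': "h' \<in> arr G" "cls h' = cls h"
      and m: "nexus G K (rn G g') (dm G h') (b, q)"
      and Z: "Z = cls (cmp G (cmp G (cores G g' (dm G b)) b) h')"
      using g h mem_class_iff by blast
    show "Z = cls w"
      unfolding Z class_eq_iff[OF nexus_product(1)[OF g'(1) h'(1) m] w(1)]
      using nexus_product[OF g'(1) h'(1) m] w g' h' class_eq_iff g h by simp
  qed
  then have "cmp Q (cls g) (cls h) = cls w" unfolding quotient_gpd_def by simp
  then show thesis using that w by simp
qed

lemma cmp_class_composable:
  assumes g: "g \<in> arr G" and h: "h \<in> arr G" and c: "rn G g = dm G h"
  shows "cmp Q (cls g) (cls h) = cls (cmp G g h)"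
proof -
  obtain w where w: "w \<in> arr G" "cmp Q (cls g) (cls h) = cls w" "\<phi> w = cmp H (\<phi> g) (\<phi> h)"
    "cls (dm G w) = cls (dm G g)"
    using cmp_class[OF g h] c by metis
  show ?thesis
    using w class_eq_iff[OF w(1) G.cmp_closed[OF g h c]] map_cmp[OF g h c] G.dm_cmp[OF g h c] by simp
qed

text \<open>
  Unit and inverse laws hold because the quotient map respects products that exist in \<open>G\<close>. Associativity
  concerns classes that may have no composable representatives; both sides have the same
  domain and, by associativity in \<open>H\<close>, the same image.
\<close>

lemma groupoid_quotient: "groupoid Q"
proof
  fix X assume "X \<in> arr Q"
  then obtain g where g: "g \<in> arr G" and X: "X = cls g" by (rule class_cases)
  note simps = dm_class rn_class g G.dm_closed G.rn_closed G.dm_dm G.dm_rn G.rn_dm G.rn_rn class_closed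
  show "dm Q X \<in> arr Q" "rn Q X \<in> arr Q" "dm Q (dm Q X) = dm Q X" "rn Q (dm Q X) = dm Q X"
    "dm Q (rn Q X) = rn Q X" "rn Q (rn Q X) = rn Q X"
    unfolding X by (simp_all add: simps)
  show "cmp Q (dm Q X) X = X" "cmp Q X (rn Q X) = X"
    unfolding X by (simp_all add: simps cmp_class_composable G.dm_cmp_id G.cmp_rn_id)
  have "dm Q (cls (ginv G g)) = rn Q X \<and> rn Q (cls (ginv G g)) = dm Q X \<and>
      cmp Q X (cls (ginv G g)) = dm Q X \<and> cmp Q (cls (ginv G g)) X = rn Q X"
    unfolding X by (simp add: simps cmp_class_composable G.ginv_closed G.dm_ginv G.rn_ginv
        G.cmp_ginv G.ginv_cmp)
  then show "\<exists>Y\<in>arr Q. dm Q Y = rn Q X \<and> rn Q Y = dm Q X \<and> cmp Q X Y = dm Q X \<and> cmp Q Y X = rn Q X"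
    using class_closed[OF G.ginv_closed[OF g]] by blast
  fix Y assume "Y \<in> arr Q" and XY: "rn Q X = dm Q Y"
  then obtain h where h: "h \<in> arr G" and Y: "Y = cls h" by (auto elim: class_cases)
  have gh: "cls (rn G g) = cls (dm G h)" using XY g h by (simp add: X Y dm_class rn_class)
  obtain v where v: "v \<in> arr G" "cmp Q X Y = cls v" "\<phi> v = cmp H (\<phi> g) (\<phi> h)"
    "cls (dm G v) = cls (dm G g)" "cls (rn G v) = cls (rn G h)"
    using cmp_class[OF g h gh] unfolding X Y by metis
  show "cmp Q X Y \<in> arr Q" "dm Q (cmp Q X Y) = dm Q X" "rn Q (cmp Q X Y) = rn Q Y"
    using v g h by (simp_all add: X Y dm_class rn_class class_closed)
  fix Z assume "Z \<in> arr Q" and YZ: "rn Q Y = dm Q Z"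
  then obtain k where k: "k \<in> arr G" and Z: "Z = cls k" by (auto elim: class_cases)
  have hk: "cls (rn G h) = cls (dm G k)" using YZ h k by (simp add: Y Z dm_class rn_class)
  obtain w where w: "w \<in> arr G" "cmp Q Y Z = cls w" "\<phi> w = cmp H (\<phi> h) (\<phi> k)"
    "cls (dm G w) = cls (dm G h)"
    using cmp_class[OF h k hk] unfolding Y Z by metis
  obtain s where s: "s \<in> arr G" "cmp Q (cls v) Z = cls s" "\<phi> s = cmp H (\<phi> v) (\<phi> k)"
    "cls (dm G s) = cls (dm G v)"
    using cmp_class[OF v(1) k] v(5) hk unfolding Z by metis
  obtain t where t: "t \<in> arr G" "cmp Q X (cls w) = cls t" "\<phi> t = cmp H (\<phi> g) (\<phi> w)"
    "cls (dm G t) = cls (dm G g)"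
    using cmp_class[OF g w(1)] w(4) gh unfolding X by metis
  have "rn H (\<phi> g) = dm H (\<phi> h)" "rn H (\<phi> h) = dm H (\<phi> k)"
    using gh hk g h k map_dm map_rn class_eq_iff[OF G.rn_closed[OF g] G.dm_closed[OF h]]
      class_eq_iff[OF G.rn_closed[OF h] G.dm_closed[OF k]] by simp_all
  then have "\<phi> s = \<phi> t" using s(3) t(3) v(3) w(3) H.cmp_assoc map_arr g h k by simp
  then show "cmp Q (cmp Q X Y) Z = cmp Q X (cmp Q Y Z)"
    using class_eq_iff[OF s(1) t(1)] s t v w by simp
qed

definition induced :: "'a set \<Rightarrow> 'b"
  where "induced X = \<phi> (SOME g. g \<in> X)"

lemma induced_class:
  assumes g: "g \<in> arr G"
  shows "induced (cls g) = \<phi> g"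
proof -
  have "g \<in> cls g" using g mem_class_iff by simp
  then have "(SOME h. h \<in> cls g) \<in> cls g" by (rule someI)
  then show ?thesis unfolding induced_def using g mem_class_iff class_eq_iff by metis
qed

lemma star_injective_induced: "star_injective_functor Q H induced"
proof (intro star_injective_functor.intro gpd_functor.intro groupoid_quotient H.groupoid_axioms
    gpd_functor_axioms.intro star_injective_functor_axioms.intro)
  fix X assume "X \<in> arr Q"
  then obtain g where g: "g \<in> arr G" and X: "X = cls g" by (rule class_cases)
  show "induced X \<in> arr H" "induced (dm Q X) = dm H (induced X)" "induced (rn Q X) = rn H (induced X)"
    using g by (simp_all add: X induced_class dm_class rn_class G.dm_closed G.rn_closed
        map_arr map_dm map_rn)
  fix Y assume "Y \<in> arr Q" and XY: "rn Q X = dm Q Y"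
  then obtain h where h: "h \<in> arr G" and Y: "Y = cls h" by (auto elim: class_cases)
  have gh: "cls (rn G g) = cls (dm G h)" using XY g h by (simp add: X Y dm_class rn_class)
  obtain w where "w \<in> arr G" "cmp Q X Y = cls w" "\<phi> w = cmp H (\<phi> g) (\<phi> h)"
    using cmp_class[OF g h gh] unfolding X Y by metis
  then show "induced (cmp Q X Y) = cmp H (induced X) (induced Y)"
    using g h by (simp add: X Y induced_class)
next
  fix E
  show "inj_on induced (star Q E)"
  proof (rule inj_onI)
    fix X Y assume "X \<in> star Q E" "Y \<in> star Q E" and eq: "induced X = induced Y"
    then have "X \<in> arr Q" "Y \<in> arr Q" and d: "dm Q X = dm Q Y" unfolding star_def by auto
    then obtain g h where g: "g \<in> arr G" "X = cls g" and h: "h \<in> arr G" "Y = cls h"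
      by (metis class_cases)
    show "X = Y" using eq d g h class_eq_iff by (simp add: induced_class dm_class)
  qed
qed

end


section \<open>The factorization\<close>

theorem theorem3p15:
  fixes G :: "'a ogpd" and H :: "'b ogpd" and \<theta> :: "'a \<Rightarrow> 'b"
  assumes "ordered_functor G H \<theta>"
  shows "\<exists>\<psi> :: 'a set \<Rightarrow> 'b.
           star_injective_functor (quotient_gpd G (gpd_kernel G H \<theta>)) H \<psi> \<and>
           (\<forall>g \<in> arr G. \<theta> g = \<psi> (qmap G (gpd_kernel G H \<theta>) g))"
  using ordered_functor.star_injective_induced[OF assms] ordered_functor.induced_class[OF assms]
  by metis

end
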